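(* Let $M$ be a nonnegative real $N\times N$ matrix defining a strongly connected graph, with dominant positive eigenvalue $\lambda$. For every stochastic matrix $S$ on $M$ with stationary probability density $\pi$, the average entropy production $$H(S)=-\sum_i \pi_i\sum_j S_{ij}\lg\!\left(\frac{S_{ij}}{M_{ij}}\right)$$ satisfies $$H(S)\le \lg(\lambda).$$
   Context: A (weighted, possibly directed) graph on vertices $\{1,\dots,N\}$ is identified with a nonnegative real $N\times N$ matrix $M$; there is an edge from $i$ to $j$ iff $M_{ij}>0$ (self-loops allowed). The graph is strongly connected if for all $i,j$ there is $l\ge 1$ with $(M^l)_{ij}>0$. The dominant positive eigenvalue $\lambda$ is the spectral radius of $M$. A matrix $S$ is stochastic on $M$ if $0\le S_{ij}\le 1$, $\sum_jS_{ij}=1$ for all $i$, and $M_{ij}=0\Rightarrow S_{ij}=0$. A stationary probability density of $S$ is a nonnegative vector $\pi$ with $\sum_i\pi_i=1$ and $\sum_i\pi_iS_{ij}=\pi_j$ for all $j$. Here $\lg=\log_2$; terms of $H(S)$ with $S_{ij}=0$ (in particular those with $M_{ij}=0$) are taken to be $0$. *)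

theory Defs
  imports "Jordan_Normal_Form.Spectral_Radius"
begin

text \<open>A weighted directed graph is its weight matrix; the vertices are indexed from \<open>0\<close>.\<close>

definition nonneg_mat :: "real mat \<Rightarrow> bool" where
  "nonneg_mat M \<longleftrightarrow> (\<forall>i < dim_row M. \<forall>j < dim_col M. 0 \<le> M $$ (i, j))"

text \<open>Because \<open>l \<ge> 1\<close>, the graph with one vertex and no loop is not strongly connected.\<close>

definition strongly_connected_mat :: "real mat \<Rightarrow> bool" where
  "strongly_connected_mat M \<longleftrightarrow>
     (\<forall>i < dim_row M. \<forall>j < dim_row M. \<exists>l \<ge> 1. 0 < (M ^\<^sub>m l) $$ (i, j))"

definition dominant_eigenvalue :: "real mat \<Rightarrow> real" where
  "dominant_eigenvalue M = spectral_radius (map_mat complex_of_real M)"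

definition stochastic_on :: "real mat \<Rightarrow> real mat \<Rightarrow> bool" where
  "stochastic_on M S \<longleftrightarrow>
     S \<in> carrier_mat (dim_row M) (dim_col M) \<and>
     (\<forall>i < dim_row M. \<forall>j < dim_col M. 0 \<le> S $$ (i, j) \<and> S $$ (i, j) \<le> 1) \<and>
     (\<forall>i < dim_row M. (\<Sum>j < dim_col M. S $$ (i, j)) = 1) \<and>
     (\<forall>i < dim_row M. \<forall>j < dim_col M. M $$ (i, j) = 0 \<longrightarrow> S $$ (i, j) = 0)"

definition stationary_density :: "real mat \<Rightarrow> real vec \<Rightarrow> bool" where
  "stationary_density S \<pi> \<longleftrightarrow>
     \<pi> \<in> carrier_vec (dim_row S) \<and>
     (\<forall>i < dim_row S. 0 \<le> \<pi> $ i) \<and>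
     (\<Sum>i < dim_row S. \<pi> $ i) = 1 \<and>
     (\<forall>j < dim_col S. (\<Sum>i < dim_row S. \<pi> $ i * S $$ (i, j)) = \<pi> $ j)"

definition entropy_production :: "real mat \<Rightarrow> real mat \<Rightarrow> real vec \<Rightarrow> real" where
  "entropy_production M S \<pi> =
     - (\<Sum>i < dim_row M. \<pi> $ i *
         (\<Sum>j < dim_col M. if S $$ (i, j) = 0 then 0
            else S $$ (i, j) * log 2 (S $$ (i, j) / M $$ (i, j))))"

end

theory Submission
  imports Defs
begin

text \<open>Let \<open>v\<^sub>n = M\<^sup>n 1\<close>. Gibbs' inequality in row \<open>i\<close> gives
  \<open>log (M v)\<^sub>i \<ge> h\<^sub>i + (\<Sum>j. S\<^sub>i\<^sub>j log v\<^sub>j)\<close>, where \<open>h\<^sub>i\<close> is the contribution of row \<open>i\<close> to the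
  entropy production. Averaging over the stationary density and iterating yields
  \<open>n H(S) \<le> (\<Sum>i. \<pi>\<^sub>i log (v\<^sub>n)\<^sub>i)\<close>. Since the entries of \<open>M\<^sup>n\<close> are \<open>O(\<mu>\<^sup>n)\<close> for every \<open>\<mu>\<close> above
  the spectral radius, dividing by \<open>n\<close> shows \<open>H(S) \<le> log \<mu>\<close>. No Perron eigenvector is needed.\<close>

section \<open>Gibbs' inequality\<close>

text \<open>Summing \<open>ln x \<le> x - 1\<close> at the ratios \<open>q i / (p i * T)\<close>,
  with \<open>T\<close> the total of \<open>q\<close>, weighted by \<open>p\<close>, makes the
  linear terms cancel, since \<open>p\<close> and \<open>q / T\<close> both have total 1. As
  \<open>q\<close> is not normalised, \<open>ln T\<close> remains. \<open>T\<close> is positive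
  because \<open>p\<close> is nonzero somewhere and \<open>q\<close> is positive there.\<close>

lemma gibbs_log2:
  fixes p q :: "'a \<Rightarrow> real"
  assumes "finite I"
    and p_nonneg: "\<And>i. i \<in> I \<Longrightarrow> 0 \<le> p i" and p_sum: "(\<Sum>i\<in>I. p i) = 1"
    and q_nonneg: "\<And>i. i \<in> I \<Longrightarrow> 0 \<le> q i"
    and supp: "\<And>i. i \<in> I \<Longrightarrow> p i \<noteq> 0 \<Longrightarrow> q i \<noteq> 0"
  shows "0 < sum q I"
    and "(\<Sum>i\<in>I. if p i = 0 then 0 else p i * log 2 (q i / p i)) \<le> log 2 (sum q I)"
proof -
  obtain a where a: "a \<in> I" "p a \<noteq> 0"
    using p_sum by (metis sum.neutral zero_neq_one)
  have "0 < q a" using a supp q_nonneg by (metis less_eq_real_def)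
  then show pos: "0 < sum q I"
    using a \<open>finite I\<close> q_nonneg by (meson sum_pos2)
  let ?T = "sum q I"
  have term_le: "(if p i = 0 then 0 else p i * ln (q i / p i)) \<le> q i / ?T - p i + p i * ln ?T"
    \<comment> \<open>Where \<open>p i = 0\<close> the left side is 0 by convention, and the right
      side is the nonnegative number \<open>q i / T\<close>.\<close>
    if i: "i \<in> I" for i
  proof (cases "p i = 0")
    case True
    then show ?thesis using q_nonneg[OF i] pos by simp
  next
    case False
    have pq: "0 < p i" "0 < q i"
      using p_nonneg[OF i] q_nonneg[OF i] supp[OF i] False by auto
    have "ln (q i / p i / ?T) \<le> q i / p i / ?T - 1"
      using pq pos by (intro ln_le_minus_one) simp
    moreover have "ln (q i / p i / ?T) = ln (q i / p i) - ln ?T"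
      using pq pos by (intro ln_divide_pos) auto
    ultimately have "ln (q i / p i) \<le> q i / p i / ?T - 1 + ln ?T" by linarith
    then have "p i * ln (q i / p i) \<le> p i * (q i / p i / ?T - 1 + ln ?T)"
      using pq by (intro mult_left_mono) auto
    also have "\<dots> = q i / ?T - p i + p i * ln ?T"
      using pq by (simp add: algebra_simps)
    finally show ?thesis using False by simp
  qed
  have "(\<Sum>i\<in>I. if p i = 0 then 0 else p i * ln (q i / p i))
      \<le> (\<Sum>i\<in>I. q i / ?T - p i + p i * ln ?T)"
    by (intro sum_mono term_le)
  also have "\<dots> = ln ?T"
    using pos p_sum
    by (simp add: sum.distrib sum_subtractf sum_divide_distrib[symmetric] sum_distrib_right[symmetric])
  finally have ln_le: "(\<Sum>i\<in>I. if p i = 0 then 0 else p i * ln (q i / p i)) \<le> ln ?T" .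
  have "(\<Sum>i\<in>I. if p i = 0 then 0 else p i * log 2 (q i / p i))
      = (\<Sum>i\<in>I. if p i = 0 then 0 else p i * ln (q i / p i)) / ln 2"
    unfolding sum_divide_distrib by (intro sum.cong) (auto simp: log_def)
  also have "\<dots> \<le> ln ?T / ln 2"
    using ln_le by (intro divide_right_mono) auto
  finally show "(\<Sum>i\<in>I. if p i = 0 then 0 else p i * log 2 (q i / p i)) \<le> log 2 ?T"
    by (simp add: log_def)
qed

section \<open>Matrix powers and the spectral radius\<close>

text \<open>The defining recursion of the power puts the new factor on the right. With the factor on
  the left, the first step of a walk can be split off.\<close>

lemma pow_mat_Suc_left:
  assumes A: "(A :: 'a :: semiring_1 mat) \<in> carrier_mat n n"
  shows "A ^\<^sub>m Suc k = A * A ^\<^sub>m k"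
proof (induction k)
  case 0
  then show ?case using A by simp
next
  case (Suc k)
  have "A ^\<^sub>m Suc (Suc k) = A * A ^\<^sub>m k * A" using Suc by simp
  also have "\<dots> = A * (A ^\<^sub>m k * A)"
    using A by (intro assoc_mult_mat) auto
  finally show ?case by simp
qed

lemma smult_pow_mat:
  assumes A: "(A :: 'a :: comm_semiring_1 mat) \<in> carrier_mat n n"
  shows "(c \<cdot>\<^sub>m A) ^\<^sub>m k = c ^ k \<cdot>\<^sub>m A ^\<^sub>m k"
proof (induction k)
  case 0
  then show ?case using A by auto
next
  case (Suc k)
  have Ak: "A ^\<^sub>m k \<in> carrier_mat n n" using A by simp
  have "(c \<cdot>\<^sub>m A) ^\<^sub>m Suc k = (c ^ k \<cdot>\<^sub>m A ^\<^sub>m k) * (c \<cdot>\<^sub>m A)" using Suc by simp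
  also have "\<dots> = c \<cdot>\<^sub>m (c ^ k \<cdot>\<^sub>m (A ^\<^sub>m k * A))"
    using A Ak by (metis mult_smult_assoc_mat mult_smult_distrib smult_carrier_mat)
  also have "\<dots> = c ^ Suc k \<cdot>\<^sub>m A ^\<^sub>m Suc k"
    using A Ak by (intro eq_matI) (auto simp: mult.assoc)
  finally show ?case .
qed

text \<open>The same eigenvector serves. Pulling eigenvalues back to \<open>A\<close> bounds the
  spectral radius of the scaled matrix from above.\<close>

lemma eigenvalue_smult_mat:
  assumes A: "(A :: 'a :: field mat) \<in> carrier_mat n n" and c: "c \<noteq> 0"
    and ev: "eigenvalue (c \<cdot>\<^sub>m A) e"
  shows "eigenvalue A (e / c)"
proof -
  obtain v where v: "v \<in> carrier_vec n" "v \<noteq> 0\<^sub>v n" "(c \<cdot>\<^sub>m A) *\<^sub>v v = e \<cdot>\<^sub>v v"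
    using ev A unfolding eigenvalue_def eigenvector_def by auto
  have "A *\<^sub>v v = (e / c) \<cdot>\<^sub>v v"
  proof (rule eq_vecI)
    fix i assume "i < dim_vec ((e / c) \<cdot>\<^sub>v v)"
    then have i: "i < n" using v by simp
    have "((c \<cdot>\<^sub>m A) *\<^sub>v v) $ i = (e \<cdot>\<^sub>v v) $ i" using v by simp
    then have "c * (A *\<^sub>v v) $ i = e * v $ i" using i A v(1) by simp
    then show "(A *\<^sub>v v) $ i = ((e / c) \<cdot>\<^sub>v v) $ i"
      using i v c by (simp add: field_simps)
  qed (use A v in auto)
  then show ?thesis using v A unfolding eigenvalue_def eigenvector_def by auto
qed

lemma spectral_radius_nonneg:
  assumes "A \<in> carrier_mat n n" and "n > 0"
  shows "0 \<le> spectral_radius A"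
  using spectral_radius_mem_max(1)[OF assms] by auto

text \<open>Scaling by \<open>1 / \<mu>\<close> brings the spectral radius strictly below 1, where
  the Jordan normal form keeps all powers bounded. The strict gap absorbs the polynomial factors
  that Jordan blocks can contribute.\<close>

lemma pow_mat_entries_bound:
  assumes A: "A \<in> carrier_mat n n" and n: "n > 0" and \<mu>: "spectral_radius A < \<mu>"
  shows "\<exists>c. \<forall>k. \<forall>i < n. \<forall>j < n. norm ((A ^\<^sub>m k) $$ (i, j)) \<le> c * \<mu> ^ k"
proof -
  have \<mu>_pos: "0 < \<mu>" using spectral_radius_nonneg[OF A n] \<mu> by linarith
  define b :: complex where "b = complex_of_real (1 / \<mu>)"
  have b: "b \<noteq> 0" "norm b = 1 / \<mu>" using \<mu>_pos by (auto simp: b_def norm_divide)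
  have bA: "b \<cdot>\<^sub>m A \<in> carrier_mat n n" using A by simp
  obtain e where e: "e \<in> spectrum (b \<cdot>\<^sub>m A)" "spectral_radius (b \<cdot>\<^sub>m A) = norm e"
    using spectral_radius_mem_max(1)[OF bA n] by auto
  \<comment> \<open>\<open>e\<close> is an eigenvalue of largest modulus of the scaled matrix, and
    \<open>norm (e / b) = norm e * \<mu>\<close>. So \<open>norm e < 1\<close> follows from the
    spectral radius of \<open>A\<close> being below \<open>\<mu>\<close>.\<close>
  have "e / b \<in> spectrum A"
    using eigenvalue_smult_mat[OF A b(1)] e(1) by (simp add: spectrum_def)
  then have "norm (e / b) \<le> spectral_radius A"
    using spectral_radius_mem_max(2)[OF A n] by blast
  then have "norm e * \<mu> < \<mu>" using \<mu> b by (simp add: norm_divide)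
  then have "spectral_radius (b \<cdot>\<^sub>m A) < 1" using e \<mu>_pos by simp
  from spectral_radius_jnf_norm_bound_less_1_upper_triangular[OF bA this]
  obtain c where c: "norm_bound ((b \<cdot>\<^sub>m A) ^\<^sub>m k) c" for k by blast
  have "norm ((A ^\<^sub>m k) $$ (i, j)) \<le> c * \<mu> ^ k" if ij: "i < n" "j < n" for k i j
  proof -
    have Ak: "A ^\<^sub>m k \<in> carrier_mat n n" using A by simp
    have "norm ((b ^ k \<cdot>\<^sub>m A ^\<^sub>m k) $$ (i, j)) \<le> c"
      using c[of k] ij carrier_matD[OF Ak]
      unfolding smult_pow_mat[OF A] norm_bound_def by (simp del: pow_mat_dim)
    then have "norm ((A ^\<^sub>m k) $$ (i, j)) / \<mu> ^ k \<le> c"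
      using ij A b by (simp add: norm_mult norm_power power_divide)
    then show ?thesis using \<mu>_pos by (simp add: divide_le_eq)
  qed
  then show ?thesis by blast
qed

text \<open>A constant error disappears after division by \<open>n\<close> as \<open>n\<close>
  grows; the Archimedean property replaces the limit.\<close>

lemma le_if_nat_mult_le:
  fixes x y C :: real
  assumes "\<And>n. real n * x \<le> C + real n * y"
  shows "x \<le> y"
proof (rule ccontr)
  assume "\<not> x \<le> y"
  then obtain n where "C < real n * (x - y)"
    using reals_Archimedean3[of "x - y"] by auto
  then show False using assms[of n] by (simp add: algebra_simps)
qed

section \<open>Entropy production and path weights\<close>

locale stochastic_weights =
  fixes N :: nat and M S :: "real mat" and \<pi> :: "real Matrix.vec"
  assumes M: "M \<in> carrier_mat N N"
    and M_nonneg: "nonneg_mat M"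
    and S_on: "stochastic_on M S"
    and stationary: "stationary_density S \<pi>"
begin

lemma S: "S \<in> carrier_mat N N"
  using S_on M by (auto simp: stochastic_on_def)

text \<open>An empty density would sum to 0 instead of 1. Positive dimension ensures that the
  spectrum is nonempty, so that the facts on the spectral radius apply.\<close>

lemma N_pos: "0 < N"
  using stationary S by (cases N) (auto simp: stationary_density_def)

text \<open>This is entry \<open>i\<close> of \<open>v\<^sub>n = M\<^sup>n 1\<close>: the total
  weight of all walks of length \<open>n\<close> starting at \<open>i\<close>.\<close>

definition path_weight :: "nat \<Rightarrow> nat \<Rightarrow> real" where
  "path_weight n i = (\<Sum>j<N. (M ^\<^sub>m n) $$ (i, j))"

lemma path_weight_0:
  assumes "i < N" shows "path_weight 0 i = 1"
  using assms M by (simp add: path_weight_def)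

lemma path_weight_Suc:
  assumes i: "i < N"
  shows "path_weight (Suc n) i = (\<Sum>j<N. M $$ (i, j) * path_weight n j)"
proof -
  have Mn: "M ^\<^sub>m n \<in> carrier_mat N N" using M by simp
  have "path_weight (Suc n) i = (\<Sum>j<N. \<Sum>k<N. M $$ (i, k) * (M ^\<^sub>m n) $$ (k, j))"
    unfolding path_weight_def pow_mat_Suc_left[OF M]
    using M Mn i by (intro sum.cong) (auto simp: scalar_prod_def lessThan_atLeast0)
  also have "\<dots> = (\<Sum>k<N. M $$ (i, k) * path_weight n k)"
    unfolding path_weight_def sum_distrib_left by (rule sum.swap)
  finally show ?thesis .
qed

abbreviation row_entropy :: "nat \<Rightarrow> real" where
  "row_entropy i \<equiv> - (\<Sum>j<N. if S $$ (i, j) = 0 then 0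
      else S $$ (i, j) * log 2 (S $$ (i, j) / M $$ (i, j)))"

lemma entropy_production_eq: "entropy_production M S \<pi> = (\<Sum>i<N. \<pi> $ i * row_entropy i)"
  using M by (simp add: entropy_production_def sum_negf)

text \<open>Gibbs' inequality with row \<open>i\<close> of \<open>S\<close> as \<open>p\<close> and
  \<open>M $$ (i, j) * v j\<close> as \<open>q j\<close>. The support condition holds because
  \<open>S\<close> vanishes where \<open>M\<close> does and \<open>v\<close> is positive.\<close>

lemma row_step:
  assumes i: "i < N" and v: "\<And>j. j < N \<Longrightarrow> 0 < v j"
  shows "0 < (\<Sum>j<N. M $$ (i, j) * v j)"
    and "row_entropy i + (\<Sum>j<N. S $$ (i, j) * log 2 (v j)) \<le> log 2 (\<Sum>j<N. M $$ (i, j) * v j)"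
proof -
  have M0: "0 \<le> M $$ (i, j)" if "j < N" for j
    using M_nonneg M i that by (auto simp: nonneg_mat_def)
  have S0: "0 \<le> S $$ (i, j)" if "j < N" for j
    using S_on M i that by (auto simp: stochastic_on_def)
  have supp: "M $$ (i, j) \<noteq> 0" if "j < N" "S $$ (i, j) \<noteq> 0" for j
    using S_on M i that by (auto simp: stochastic_on_def)
  have S1: "(\<Sum>j<N. S $$ (i, j)) = 1"
    using S_on M i by (auto simp: stochastic_on_def)
  have q0: "0 \<le> M $$ (i, j) * v j" if "j \<in> {..<N}" for j
    using M0[of j] v[of j] that by simp
  have q1: "M $$ (i, j) * v j \<noteq> 0" if "j \<in> {..<N}" "S $$ (i, j) \<noteq> 0" for j
    using supp[of j] v[of j] that by simp
  note gibbs = gibbs_log2[of "{..<N}" "\<lambda>j. S $$ (i, j)" "\<lambda>j. M $$ (i, j) * v j", OF _ _ S1 q0 q1]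
  show "0 < (\<Sum>j<N. M $$ (i, j) * v j)"
    by (rule gibbs(1)) (use S0 in auto)
  \<comment> \<open>On the support of \<open>S\<close> the logarithm of \<open>M * v / S\<close>
    splits into \<open>log v\<close> minus \<open>log (S / M)\<close>; off the support both sides
    contribute 0.\<close>
  have "row_entropy i + (\<Sum>j<N. S $$ (i, j) * log 2 (v j))
      = (\<Sum>j<N. if S $$ (i, j) = 0 then 0
           else S $$ (i, j) * log 2 (M $$ (i, j) * v j / S $$ (i, j)))"
    unfolding sum_negf[symmetric] sum.distrib[symmetric]
  proof (intro sum.cong refl)
    fix j assume "j \<in> {..<N}"
    then have j: "j < N" by simp
    show "- (if S $$ (i, j) = 0 then 0 else S $$ (i, j) * log 2 (S $$ (i, j) / M $$ (i, j)))
        + S $$ (i, j) * log 2 (v j)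
      = (if S $$ (i, j) = 0 then 0
           else S $$ (i, j) * log 2 (M $$ (i, j) * v j / S $$ (i, j)))"
    proof (cases "S $$ (i, j) = 0")
      case False
      have "0 < S $$ (i, j)" "0 < M $$ (i, j)"
        using False S0[OF j] M0[OF j] supp[OF j] by auto
      then show ?thesis
        using v[OF j] by (simp add: log_divide log_mult algebra_simps)
    qed simp
  qed
  also have "\<dots> \<le> log 2 (\<Sum>j<N. M $$ (i, j) * v j)"
    by (rule gibbs(2)) (use S0 in auto)
  finally show "row_entropy i + (\<Sum>j<N. S $$ (i, j) * log 2 (v j))
      \<le> log 2 (\<Sum>j<N. M $$ (i, j) * v j)" .
qed

text \<open>Each row of \<open>S\<close> sums to 1 and is supported on \<open>M\<close>, so each row
  of \<open>M\<close> has a positive entry and positivity passes from \<open>v\<^sub>n\<close> to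
  its image under \<open>M\<close>.\<close>

lemma path_weight_pos:
  assumes "i < N" shows "0 < path_weight n i"
  using assms
proof (induction n arbitrary: i)
  case 0
  then show ?case by (simp add: path_weight_0)
next
  case (Suc n)
  then show ?case using row_step(1) by (simp add: path_weight_Suc)
qed

lemma density_nonneg: "i < N \<Longrightarrow> 0 \<le> \<pi> $ i"
  and density_sum: "(\<Sum>i<N. \<pi> $ i) = 1"
  and density_invariant: "j < N \<Longrightarrow> (\<Sum>i<N. \<pi> $ i * S $$ (i, j)) = \<pi> $ j"
  using stationary S by (auto simp: stationary_density_def)

text \<open>Induction on \<open>n\<close>: each application of \<open>M\<close> gains one
  \<open>H(S)\<close>, because averaging the row inequality over the stationary density turns the
  \<open>S\<close>-average of the logarithms back into their average under \<open>\<pi>\<close>. At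
  \<open>n = 0\<close> both sides are 0, since \<open>v\<^sub>0\<close> is constantly 1.\<close>

lemma mult_entropy_le_path_weight:
  "real n * entropy_production M S \<pi> \<le> (\<Sum>i<N. \<pi> $ i * log 2 (path_weight n i))"
proof (induction n)
  case 0
  then show ?case by (simp add: path_weight_0)
next
  case (Suc n)
  let ?v = "\<lambda>j. log 2 (path_weight n j)"
  \<comment> \<open>Invariance is read from right to left: \<open>\<pi>\<close> is replaced by its
    image under \<open>S\<close>, so that the row inequality becomes applicable.\<close>
  have "(\<Sum>j<N. \<pi> $ j * ?v j) = (\<Sum>j<N. (\<Sum>i<N. \<pi> $ i * S $$ (i, j)) * ?v j)"
    by (simp add: density_invariant)
  also have "\<dots> = (\<Sum>j<N. \<Sum>i<N. \<pi> $ i * (S $$ (i, j) * ?v j))"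
    by (simp add: sum_distrib_right mult.assoc)
  also have "\<dots> = (\<Sum>i<N. \<Sum>j<N. \<pi> $ i * (S $$ (i, j) * ?v j))"
    by (rule sum.swap)
  finally have shift: "(\<Sum>j<N. \<pi> $ j * ?v j) = (\<Sum>i<N. \<pi> $ i * (\<Sum>j<N. S $$ (i, j) * ?v j))"
    by (simp add: sum_distrib_left)
  have "real (Suc n) * entropy_production M S \<pi>
      \<le> entropy_production M S \<pi> + (\<Sum>j<N. \<pi> $ j * ?v j)"
    using Suc by (simp add: algebra_simps)
  also have "\<dots> = (\<Sum>i<N. \<pi> $ i * (row_entropy i + (\<Sum>j<N. S $$ (i, j) * ?v j)))"
    unfolding shift entropy_production_eq distrib_left sum.distrib ..
  also have "\<dots> \<le> (\<Sum>i<N. \<pi> $ i * log 2 (path_weight (Suc n) i))"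
    using row_step(2)[of _ "path_weight n"] path_weight_pos
    by (intro sum_mono mult_left_mono) (auto simp: path_weight_Suc density_nonneg)
  finally show ?case .
qed

section \<open>Comparison with the spectral radius\<close>

lemma entropy_le_log_above_spectral_radius:
  assumes \<mu>: "dominant_eigenvalue M < \<mu>"
  shows "entropy_production M S \<pi> \<le> log 2 \<mu>"
proof -
  let ?A = "map_mat complex_of_real M"
  have A: "?A \<in> carrier_mat N N" using M by simp
  have sr: "spectral_radius ?A < \<mu>" using \<mu> by (simp add: dominant_eigenvalue_def)
  have \<mu>_pos: "0 < \<mu>" using spectral_radius_nonneg[OF A N_pos] sr by linarith
  obtain c where c: "norm ((?A ^\<^sub>m k) $$ (i, j)) \<le> c * \<mu> ^ k" if "i < N" "j < N" for k i j
    using pow_mat_entries_bound[OF A N_pos sr] by blast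
  have entry: "(M ^\<^sub>m k) $$ (i, j) \<le> c * \<mu> ^ k" if ij: "i < N" "j < N" for k i j
  proof -
    \<comment> \<open>Embedding the reals into the complex numbers commutes with matrix powers, so
      the complex norm bound also bounds the real entry.\<close>
    have "(?A ^\<^sub>m k) $$ (i, j) = complex_of_real ((M ^\<^sub>m k) $$ (i, j))"
      unfolding of_real_hom.mat_hom_pow[OF M, symmetric] using ij M by simp
    then show ?thesis using c[OF ij, of k] by simp
  qed
  have weight: "path_weight n i \<le> real N * c * \<mu> ^ n" if "i < N" for n i
  proof -
    have "path_weight n i \<le> (\<Sum>j<N. c * \<mu> ^ n)"
      unfolding path_weight_def using entry that by (intro sum_mono) auto
    then show ?thesis by simp
  qed
  \<comment> \<open>The bound at \<open>n = 0\<close> and vertex 0 reads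
    \<open>1 \<le> real N * c\<close>. Positivity is what permits splitting the logarithm of the
    product below.\<close>
  have C: "0 < real N * c" using weight[of 0 0] path_weight_0[of 0] N_pos by simp
  have "real n * entropy_production M S \<pi> \<le> log 2 (real N * c) + real n * log 2 \<mu>" for n
  proof -
    have "real n * entropy_production M S \<pi> \<le> (\<Sum>i<N. \<pi> $ i * log 2 (path_weight n i))"
      by (rule mult_entropy_le_path_weight)
    \<comment> \<open>The new bound does not depend on \<open>i\<close>, so the average over
      \<open>\<pi>\<close> collapses because the density has total 1.\<close>
    also have "\<dots> \<le> (\<Sum>i<N. \<pi> $ i * log 2 (real N * c * \<mu> ^ n))"
      using weight path_weight_pos
      by (intro sum_mono mult_left_mono log_mono) (auto simp: density_nonneg)
    also have "\<dots> = log 2 (real N * c * \<mu> ^ n)"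
      unfolding sum_distrib_right[symmetric] density_sum by simp
    also have "\<dots> = log 2 (real N * c) + real n * log 2 \<mu>"
      using C \<mu>_pos by (simp only: log_mult_pos zero_less_power log_nat_power)
    finally show ?thesis .
  qed
  then show ?thesis by (rule le_if_nat_mult_le)
qed

text \<open>Let \<open>\<mu>\<close> decrease to the dominant eigenvalue. The limit is taken for
  \<open>2 powr H\<close> rather than for logarithms, as the eigenvalue is not yet known to be
  positive; its positivity then follows from that of \<open>2 powr H\<close>.\<close>

lemma entropy_le_log_spectral_radius:
  "entropy_production M S \<pi> \<le> log 2 (dominant_eigenvalue M)"
proof -
  let ?H = "entropy_production M S \<pi>"
  have radius_nonneg: "0 \<le> dominant_eigenvalue M"
    using spectral_radius_nonneg[OF _ N_pos] M by (simp add: dominant_eigenvalue_def)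
  have ge: "2 powr ?H \<le> dominant_eigenvalue M"
  proof (rule dense_ge)
    fix \<mu> assume \<mu>: "dominant_eigenvalue M < \<mu>"
    then show "2 powr ?H \<le> \<mu>"
      using entropy_le_log_above_spectral_radius[OF \<mu>] radius_nonneg
      by (simp add: le_log_iff)
  qed
  moreover have "0 < 2 powr ?H" by simp
  ultimately have "0 < dominant_eigenvalue M" by linarith
  then show ?thesis using ge by (simp add: le_log_iff)
qed

end

theorem mainTheorem4:
  fixes M S :: "real mat" and \<pi> :: "real Matrix.vec" and N :: nat
  assumes "M \<in> carrier_mat N N"
    and "nonneg_mat M"
    and "strongly_connected_mat M"
    and "stochastic_on M S"
    and "stationary_density S \<pi>"
  shows "entropy_production M S \<pi> \<le> log 2 (dominant_eigenvalue M)"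
proof -
  interpret stochastic_weights N M S \<pi>
    using assms by unfold_locales
  show ?thesis by (rule entropy_le_log_spectral_radius)
qed

end
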